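(* Let $X$ be a proper, geodesically complete $\mathrm{CAT}(-\kappa)$ space with height function $h_X$ based at $\infty_X\in\partial X$, let $N$ be an admissible monotone norm, and let $X'=(X,d'_X)$. If $f$ is an isometry of $X'$ whose boundary extension fixes $\infty_X$, then $h_X(f(x))-h_X(x)$ does not depend on $x\in X$.
   Context: $d'_X$ is the length metric on $X$ in which a path $\gamma$ has length $\sup_{0=t_0<\dots<t_n=1}\sum_iN(d_X(\gamma(t_i),\gamma(t_{i+1})),|h_X(\gamma(t_i))-h_X(\gamma(t_{i+1}))|)$, where $N$ is a norm on $\mathbb{R}^2$ with $N(1,1)=1$, $N(a,b)\ge(|a|+|b|)/2$, non-decreasing in each coordinate on $[0,\infty)^2$. $d'_X$ differs from $d_X$ by a bounded amount, so $X'$ is Gromov-hyperbolic with the same boundary as $X$, and isometries of $X'$ extend to the boundary. Height function: $h_X(x)=-\lim_{t\to\infty}[d_X(\gamma(t),x)-d_X(\gamma(t),x_0)]$ for a ray $\gamma$ representing $\infty_X$. *)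

theory Defs
  imports "HOL-Analysis.Analysis"
begin

definition geodesic_seg :: "(real \<Rightarrow> 'a::metric_space) \<Rightarrow> real \<Rightarrow> 'a \<Rightarrow> 'a \<Rightarrow> bool" where
  "geodesic_seg c L x y \<longleftrightarrow> L \<ge> 0 \<and> c 0 = x \<and> c L = y \<and>
     (\<forall>s\<in>{0..L}. \<forall>t\<in>{0..L}. dist (c s) (c t) = \<bar>s - t\<bar>)"

definition geodesic_space :: "'a::metric_space itself \<Rightarrow> bool" where
  "geodesic_space _ \<longleftrightarrow> (\<forall>x y::'a. \<exists>c. geodesic_seg c (dist x y) x y)"

definition geodesic_ray :: "(real \<Rightarrow> 'a::metric_space) \<Rightarrow> bool" where
  "geodesic_ray c \<longleftrightarrow> (\<forall>s\<ge>0. \<forall>t\<ge>0. dist (c s) (c t) = \<bar>s - t\<bar>)"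

definition geodesic_line :: "(real \<Rightarrow> 'a::metric_space) \<Rightarrow> bool" where
  "geodesic_line c \<longleftrightarrow> (\<forall>s t. dist (c s) (c t) = \<bar>s - t\<bar>)"

definition geodesically_complete :: "'a::metric_space itself \<Rightarrow> bool" where
  "geodesically_complete _ \<longleftrightarrow>
     (\<forall>(c::real \<Rightarrow> 'a) L x y. L > 0 \<longrightarrow> geodesic_seg c L x y \<longrightarrow>
        (\<exists>l. geodesic_line l \<and> (\<forall>t\<in>{0..L}. l t = c t)))"

definition proper_space :: "'a::metric_space itself \<Rightarrow> bool" where
  "proper_space _ \<longleftrightarrow> (\<forall>(x::'a) r. compact (cball x r))"

text \<open>CAT(-k), k > 0: X is geodesic, and for every geodesic triangle with vertex x
  and sides [x,y], [x,z], the distance between the point at distance s from x on [x,y]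
  and the point at distance t from x on [x,z] is at most the distance of the
  corresponding points in the comparison triangle in the hyperbolic plane of curvature -k,
  the latter computed by the hyperbolic law of cosines (via the comparison angle at x).\<close>
definition comparison_cosh :: "real \<Rightarrow> real \<Rightarrow> real \<Rightarrow> real \<Rightarrow> real \<Rightarrow> real \<Rightarrow> real" where
  "comparison_cosh k a b c u v =
     (let r = sqrt k;
          cosang = (cosh (r*a) * cosh (r*b) - cosh (r*c)) / (sinh (r*a) * sinh (r*b))
      in cosh (r * u) * cosh (r * v) - sinh (r * u) * sinh (r * v) * cosang)"

definition CAT_neg :: "real \<Rightarrow> 'a::metric_space itself \<Rightarrow> bool" where
  "CAT_neg k T \<longleftrightarrow> geodesic_space T \<and>
     (\<forall>(x::'a) y z c1 c2. geodesic_seg c1 (dist x y) x y \<longrightarrow> geodesic_seg c2 (dist x z) x z \<longrightarrow>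
        dist x y > 0 \<longrightarrow> dist x z > 0 \<longrightarrow>
        (\<forall>s\<in>{0..dist x y}. \<forall>t\<in>{0..dist x z}.
           cosh (sqrt k * dist (c1 s) (c2 t)) \<le> comparison_cosh k (dist x y) (dist x z) (dist y z) s t))"

definition height :: "(real \<Rightarrow> 'a::metric_space) \<Rightarrow> 'a \<Rightarrow> 'a \<Rightarrow> real" where
  "height \<gamma> x0 x = - Lim at_top (\<lambda>t. dist (\<gamma> t) x - dist (\<gamma> t) x0)"

definition gromov_product :: "'a::metric_space \<Rightarrow> 'a \<Rightarrow> 'a \<Rightarrow> real" where
  "gromov_product w x y = (dist x w + dist y w - dist x y) / 2"

definition is_norm2 :: "(real \<times> real \<Rightarrow> real) \<Rightarrow> bool" where
  "is_norm2 N \<longleftrightarrow> (\<forall>a b. N (a, b) \<ge> 0) \<and> (\<forall>a b. N (a, b) = 0 \<longleftrightarrow> a = 0 \<and> b = 0) \<and>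
     (\<forall>c a b. N (c*a, c*b) = \<bar>c\<bar> * N (a, b)) \<and>
     (\<forall>a b a' b'. N (a + a', b + b') \<le> N (a, b) + N (a', b'))"

definition admissible_monotone_norm :: "(real \<times> real \<Rightarrow> real) \<Rightarrow> bool" where
  "admissible_monotone_norm N \<longleftrightarrow> is_norm2 N \<and> N (1, 1) = 1 \<and>
     (\<forall>a b. N (a, b) \<ge> (\<bar>a\<bar> + \<bar>b\<bar>) / 2) \<and>
     (\<forall>a b a' b'. 0 \<le> a \<longrightarrow> a \<le> a' \<longrightarrow> 0 \<le> b \<longrightarrow> b \<le> b' \<longrightarrow> N (a, b) \<le> N (a', b'))"

definition Nlength :: "(real \<times> real \<Rightarrow> real) \<Rightarrow> ('a::metric_space \<Rightarrow> real) \<Rightarrow> (real \<Rightarrow> 'a) \<Rightarrow> ereal" where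
  "Nlength N h p = Sup {ereal (\<Sum>i<n. N (dist (p (t i)) (p (t (Suc i))), \<bar>h (p (t i)) - h (p (t (Suc i)))\<bar>))
       | n t. t 0 = 0 \<and> t n = 1 \<and> (\<forall>i<n. t i < t (Suc i))}"

definition dprime :: "(real \<times> real \<Rightarrow> real) \<Rightarrow> ('a::metric_space \<Rightarrow> real) \<Rightarrow> 'a \<Rightarrow> 'a \<Rightarrow> real" where
  "dprime N h x y = real_of_ereal (Inf {Nlength N h p | p. continuous_on {0..1} p \<and> p 0 = x \<and> p 1 = y})"

end

(* The hypotheses on N give (d + |dh|)/2 <= d' <= d. Hence both gamma and sigma = f o gamma are unit
   speed for d', and t - h(sigma t) is non-decreasing. Since sigma is a d-quasigeodesic that converges
   to the endpoint of gamma, the stability of quasigeodesics keeps it within bounded distance of gamma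
   at arbitrarily large times, so t - h(sigma t) is bounded and converges. Then sigma is almost vertical
   far out: d(sigma s, sigma t) - (h(sigma t) - h(sigma s)) is small for large s <= t, and by continuity
   of Busemann functions d(sigma t, y) - (h(sigma t) - h(y)) tends to 0 for every y, hence so does
   d'(sigma t, y) - (h(sigma t) - h(y)). The same holds for gamma. Comparing d'(sigma t, f x) with
   d'(gamma t, x) identifies h(f x) - h(x) with the limit of h(sigma t) - h(gamma t), which does not
   involve x. *)
theory Submission
  imports Defs "HOL-Real_Asymp.Real_Asymp"
begin

section \<open>Elementary facts on monotone limits, geodesics and Gromov products\<close>

lemma nonincreasing_tendsto_at_top:
  fixes g :: "real \<Rightarrow> real"
  assumes anti: "\<And>s t. 0 \<le> s \<Longrightarrow> s \<le> t \<Longrightarrow> g t \<le> g s"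
    and bound: "\<And>t. 0 \<le> t \<Longrightarrow> C \<le> g t"
  obtains l where "(g \<longlongrightarrow> l) at_top"
proof -
  define l where "l = Inf (g ` {0..})"
  have bdd: "bdd_below (g ` {0..})"
    using bound by (auto intro!: bdd_belowI2)
  have "(g \<longlongrightarrow> l) at_top"
  proof (rule decreasing_tendsto)
    show "\<forall>\<^sub>F t in at_top. l \<le> g t"
      using eventually_ge_at_top[of 0]
      by eventually_elim (auto simp: l_def intro!: cInf_lower bdd)
  next
    fix x assume "l < x"
    then obtain s where s: "0 \<le> s" "g s < x"
      unfolding l_def using cInf_less_iff[OF _ bdd] by auto
    show "\<forall>\<^sub>F t in at_top. g t < x"
      using eventually_ge_at_top[of s]
      by eventually_elim (use anti s in force)
  qed
  then show thesis by (rule that)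
qed

lemma geodesic_seg_reverse:
  "geodesic_seg c L x y \<Longrightarrow> geodesic_seg (\<lambda>t. c (L - t)) L y x"
  unfolding geodesic_seg_def by auto

lemma geodesic_seg_dist:
  assumes "geodesic_seg c L x y" "0 \<le> u" "u \<le> L"
  shows "dist x (c u) = u" "dist (c u) y = L - u"
  using assms unfolding geodesic_seg_def by force+

lemma geodesic_ray_seg:
  assumes "geodesic_ray g" "0 \<le> T"
  shows "geodesic_seg g T (g 0) (g T)"
  using assms unfolding geodesic_ray_def geodesic_seg_def by auto

lemma geodesic_ray_dist:
  assumes "geodesic_ray g" "0 \<le> s" "0 \<le> t"
  shows "dist (g s) (g t) = \<bar>s - t\<bar>"
  using assms unfolding geodesic_ray_def by auto

lemma gromov_product_commute: "gromov_product w x y = gromov_product w y x"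
  by (simp add: gromov_product_def dist_commute)

lemma gromov_product_le: "gromov_product w x y \<le> dist w x"
  using dist_triangle[of y w x] by (simp add: gromov_product_def dist_commute)

lemma gromov_product_nonneg: "0 \<le> gromov_product w x y"
  using dist_triangle[of x y w] by (simp add: gromov_product_def dist_commute)

lemma gromov_product_base: "gromov_product w x y \<le> gromov_product v x y + dist v w"
  using dist_triangle[of x w v] dist_triangle[of y w v]
  by (simp add: gromov_product_def field_simps)

section \<open>Fellow travelling of geodesics in CAT(-k) spaces\<close>

text \<open>Half-angle formula and \<open>y \<le> sinh y\<close> for nonnegative \<open>y\<close>.
  It turns the bound on \<open>cosh\<close> supplied by the comparison inequality into a bound on
  the distance itself.\<close>

lemma cosh_ge_quadratic: "1 + x\<^sup>2 / 2 \<le> cosh (x::real)"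
proof -
  have "cosh x = 1 + 2 * (sinh (x/2))\<^sup>2"
    using cosh_double_cosh[of "x/2"] cosh_square_eq[of "x/2"] by simp
  then have "cosh x = 1 + 2 * (sinh \<bar>x/2\<bar>)\<^sup>2"
    by (simp only: sinh_real_abs power2_abs)
  moreover have "\<bar>x/2\<bar>\<^sup>2 \<le> (sinh \<bar>x/2\<bar>)\<^sup>2"
  proof (rule power_mono)
    show "\<bar>x/2\<bar> \<le> sinh \<bar>x/2\<bar>"
      using real_le_x_sinh[of "\<bar>x/2\<bar>"] by (simp add: sinh_field_def exp_minus)
  qed simp
  ultimately show ?thesis by (simp add: power_divide)
qed

lemma sinh_ge_exp:
  assumes "1 \<le> (x::real)"
  shows "exp x / 4 \<le> sinh x"
proof -
  have "2 \<le> exp x" using exp_ge_add_one_self[of x] assms by linarith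
  then have "2 * 2 \<le> exp x * exp x" by (intro mult_mono) auto
  then have "2 * exp (-x) \<le> exp x"
    by (simp add: exp_minus field_simps)
  then show ?thesis by (simp add: sinh_field_def)
qed

text \<open>A thinness condition with two separate constants. A single pair \<open>M\<close>,
  \<open>e\<close> yields Gromov hyperbolicity; having it for every \<open>e > 0\<close> gives the
  continuity of Busemann functions at the boundary.\<close>

definition fellow_travel :: "real \<Rightarrow> real \<Rightarrow> 'a::metric_space itself \<Rightarrow> bool" where
  "fellow_travel M e _ \<longleftrightarrow> (\<forall>(w::'a) x y c1 c2 u.
     geodesic_seg c1 (dist w x) w x \<longrightarrow> geodesic_seg c2 (dist w y) w y \<longrightarrow>
     0 \<le> u \<longrightarrow> u + M \<le> gromov_product w x y \<longrightarrow> dist (c1 u) (c2 u) \<le> e)"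

text \<open>With \<open>r = sqrt k\<close>, the law of cosines at equal parameters reads \<open>1 +
  sinh(ru)^2 * (cosh(rc) - cosh(ra - rb)) / (sinh(ra) * sinh(rb))\<close>. Exponential bounds on the
  factors leave \<open>4 * exp(2ru + rc - ra - rb)\<close>, whose exponent is \<open>-2r\<close>
  times the distance from \<open>u\<close> to the Gromov product
  \<open>(a + b - c) / 2\<close>.\<close>

lemma comparison_cosh_diagonal_le:
  assumes k: "k > 0" and M: "1 \<le> sqrt k * M"
    and u: "0 \<le> u" "u + M \<le> (a + b - c) / 2" and c: "0 \<le> c" "\<bar>a - b\<bar> \<le> c"
  shows "comparison_cosh k a b c u u \<le> 1 + 4 * exp (- (2 * (sqrt k * M)))"
proof -
  define r where "r = sqrt k"
  have r: "r > 0" using k by (simp add: r_def)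
  have M': "1 \<le> r * M" using M by (simp add: r_def)
  have ab: "M \<le> a" "M \<le> b" using u c by (auto simp: abs_le_iff)
  have ra: "1 \<le> r * a" "1 \<le> r * b"
    using ab M' r mult_left_mono[of M a r] mult_left_mono[of M b r] by linarith+
  define P where "P = sinh (r*a) * sinh (r*b)"
  have "exp (r*a) / 4 * (exp (r*b) / 4) \<le> P"
    unfolding P_def using ra by (intro mult_mono sinh_ge_exp) auto
  then have P: "exp (r*a + r*b) / 16 \<le> P" by (simp add: exp_add)
  have Ppos: "P > 0" using P exp_gt_zero[of "r*a + r*b"] by linarith
  have eq: "comparison_cosh k a b c u u
      = 1 + (sinh (r*u))\<^sup>2 * ((cosh (r*c) - cosh (r*a - r*b)) / P)"
  proof -
    define C where "C = (cosh (r*a) * cosh (r*b) - cosh (r*c)) / P"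
    have num: "cosh (r*c) - cosh (r*a - r*b) = P - (cosh (r*a) * cosh (r*b) - cosh (r*c))"
      by (simp add: cosh_diff P_def)
    have C: "(cosh (r*c) - cosh (r*a - r*b)) / P = 1 - C"
      unfolding num C_def using Ppos by (simp add: diff_divide_distrib)
    have "comparison_cosh k a b c u u = (cosh (r*u))\<^sup>2 - (sinh (r*u))\<^sup>2 * C"
      by (simp add: comparison_cosh_def Let_def r_def P_def C_def power2_eq_square)
    then show ?thesis
      unfolding C cosh_square_eq by (simp add: right_diff_distrib)
  qed
  have e1: "(sinh (r*u))\<^sup>2 \<le> exp (2 * (r*u)) / 4"
  proof -
    have "(sinh (r*u))\<^sup>2 \<le> (exp (r*u) / 2)\<^sup>2"
      using u r by (intro power_mono) (auto simp: sinh_field_def)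
    then show ?thesis by (simp add: power_divide exp_double)
  qed
  have e2: "(cosh (r*c) - cosh (r*a - r*b)) / P \<le> 16 * exp (r*c - (r*a + r*b))"
  proof -
    have "cosh (r*c) \<le> exp (r*c)"
      using c r by (simp add: cosh_field_def field_simps)
    then have "(cosh (r*c) - cosh (r*a - r*b)) / P \<le> exp (r*c) / P"
      using Ppos cosh_real_pos[of "r*a - r*b"] by (intro divide_right_mono) linarith+
    also have "\<dots> \<le> exp (r*c) / (exp (r*a + r*b) / 16)"
      using P by (intro divide_left_mono) (auto simp: Ppos)
    finally show ?thesis by (simp add: exp_diff mult.commute)
  qed
  \<comment> \<open>The triangle inequality makes this factor nonnegative, so that \<open>e1\<close>
    and \<open>e2\<close> may be multiplied.\<close>
  have e3: "0 \<le> (cosh (r*c) - cosh (r*a - r*b)) / P"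
  proof -
    have "\<bar>r*a - r*b\<bar> \<le> r*c"
      using c r by (simp add: abs_mult flip: right_diff_distrib)
    then have "cosh \<bar>r*a - r*b\<bar> \<le> cosh (r*c)"
      using c r by (subst cosh_real_nonneg_le_iff) auto
    then show ?thesis using Ppos by simp
  qed
  have "(sinh (r*u))\<^sup>2 * ((cosh (r*c) - cosh (r*a - r*b)) / P)
      \<le> exp (2 * (r*u)) / 4 * (16 * exp (r*c - (r*a + r*b)))"
    using e1 e2 e3 by (intro mult_mono) auto
  also have "\<dots> = 4 * exp (2 * (r*u) + (r*c - (r*a + r*b)))"
    by (simp add: exp_add)
  also have "\<dots> \<le> 4 * exp (- (2 * (r * M)))"
  proof -
    have "r * (2*u + 2*M) \<le> r * (a + b - c)" using u r by (intro mult_left_mono) auto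
    then show ?thesis by (simp add: algebra_simps)
  qed
  finally show ?thesis by (simp add: eq r_def)
qed

lemma CAT_neg_fellow_travel:
  assumes k: "k > 0" and cat: "CAT_neg k TYPE('a::metric_space)" and e: "e > 0"
  obtains M where "M > 0" "fellow_travel M e TYPE('a)"
proof -
  define r where "r = sqrt k"
  have r: "r > 0" using k by (simp add: r_def)
  \<comment> \<open>Chosen so that \<open>8 * exp (- (2 * B)) \<le> 8 / B \<le> (r * e)^2\<close>;
    the maximum with 1 secures the hypothesis \<open>1 \<le> sqrt k * M\<close> of the trigonometric
    estimate.\<close>
  define B where "B = max 1 (8 / (r*e)\<^sup>2)"
  define M where "M = B / r"
  have rM: "r * M = B" using r by (simp add: M_def)
  have B: "1 \<le> B" "8 / (r*e)\<^sup>2 \<le> B" by (auto simp: B_def)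
  have "fellow_travel M e TYPE('a)"
    unfolding fellow_travel_def
  proof (intro allI impI)
    fix w x y :: 'a and c1 c2 u
    assume c: "geodesic_seg c1 (dist w x) w x" "geodesic_seg c2 (dist w y) w y"
      and u: "0 \<le> u" "u + M \<le> gromov_product w x y"
    define d where "d = dist (c1 u) (c2 u)"
    have M0: "M > 0" using B r by (simp add: M_def)
    have a: "u + M \<le> dist w x" "u + M \<le> dist w y"
      using u gromov_product_le[of w x y] gromov_product_le[of w y x]
      by (auto simp: gromov_product_commute)
    have pos: "0 < dist w x" "0 < dist w y" "u \<in> {0..dist w x}" "u \<in> {0..dist w y}"
      using a u M0 by auto
    have "cosh (sqrt k * d) \<le> comparison_cosh k (dist w x) (dist w y) (dist x y) u u"
      unfolding d_def
      using cat[unfolded CAT_neg_def] c pos by blast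
    also have "\<dots> \<le> 1 + 4 * exp (- (2 * (sqrt k * M)))"
    proof (rule comparison_cosh_diagonal_le[OF k])
      show "1 \<le> sqrt k * M" using B rM by (simp add: r_def)
      show "u + M \<le> (dist w x + dist w y - dist x y) / 2"
        using u by (simp add: gromov_product_def dist_commute)
      show "\<bar>dist w x - dist w y\<bar> \<le> dist x y"
        using dist_triangle[of w x y] dist_triangle[of w y x] by (simp add: dist_commute abs_le_iff)
    qed (use u in auto)
    finally have "(r * d)\<^sup>2 \<le> 8 * exp (- (2 * B))"
      using cosh_ge_quadratic[of "r * d"] rM by (simp add: r_def)
    also have "\<dots> \<le> 8 / B"
    proof -
      have "B \<le> exp (2 * B)" using exp_ge_add_one_self[of "2*B"] B by linarith
      then show ?thesis using B by (simp add: exp_minus field_simps)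
    qed
    also have "\<dots> \<le> (r * e)\<^sup>2"
      using B r e by (simp add: field_simps)
    finally have "r * d \<le> r * e"
      using r e by (simp add: power2_le_iff_abs_le d_def)
    then show "dist (c1 u) (c2 u) \<le> e" using r by (simp add: d_def)
  qed
  moreover have "M > 0" using B r by (simp add: M_def)
  ultimately show thesis using that by blast
qed

section \<open>Gromov hyperbolicity and stability of quasigeodesics\<close>

text \<open>At time \<open>u\<close>, which is \<open>M\<close> before the smaller product, the
  geodesics from \<open>w\<close> to \<open>x\<close>, \<open>y\<close>, \<open>z\<close> are
  successively \<open>e\<close>-close. Going from \<open>x\<close> to \<open>z\<close> through these
  three points gives \<open>dist x z \<le> dist w x + dist w z - 2 * u + 2 * e\<close>.\<close>

lemma fellow_travel_four_point:
  assumes geo: "geodesic_space TYPE('a::metric_space)" and ft: "fellow_travel M e TYPE('a)" and M: "0 \<le> M" "0 \<le> e"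
  shows "min (gromov_product w x y) (gromov_product w y z) - (M + e) \<le> gromov_product (w::'a) x z"
proof (cases "min (gromov_product w x y) (gromov_product w y z) \<le> M")
  case True
  then show ?thesis using gromov_product_nonneg[of w x z] M by linarith
next
  case False
  define u where "u = min (gromov_product w x y) (gromov_product w y z) - M"
  have u: "0 \<le> u" "u + M \<le> gromov_product w x y" "u + M \<le> gromov_product w y z"
    using False by (auto simp: u_def)
  obtain cx cy cz where c: "geodesic_seg cx (dist w x) w x" "geodesic_seg cy (dist w y) w y"
      "geodesic_seg cz (dist w z) w z"
    using geo unfolding geodesic_space_def by metis
  have d: "dist (cx u) (cy u) \<le> e" "dist (cy u) (cz u) \<le> e"
    using ft c u unfolding fellow_travel_def by blast+
  have len: "u \<le> dist w x" "u \<le> dist w z"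
    using u M gromov_product_le[of w x y] gromov_product_le[of w z y]
    by (auto simp: gromov_product_commute)
  have "dist (cx u) x = dist w x - u" "dist (cz u) z = dist w z - u"
    using geodesic_seg_dist c u len by blast+
  moreover have "dist x z \<le> dist (cx u) x + dist (cx u) (cy u) + dist (cy u) (cz u) + dist (cz u) z"
    using dist_triangle[of x z "cx u"] dist_triangle[of "cx u" z "cy u"]
      dist_triangle[of "cy u" z "cz u"] by (simp add: dist_commute)
  ultimately have "u - e \<le> gromov_product w x z"
    using d by (simp add: gromov_product_def dist_commute)
  then show ?thesis by (simp add: u_def)
qed

text \<open>Bisecting the index interval costs one \<open>\<delta>\<close> per halving, so the loss
  is only logarithmic in the number of steps. Neighbours outside the ball of radius \<open>D\<close>
  have product at least \<open>D - 1\<close>, since they are at most 2 apart.\<close>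

lemma gromov_product_chain:
  fixes z :: "nat \<Rightarrow> 'a::metric_space"
  assumes four: "\<And>(w::'a) x y v. min (gromov_product w x y) (gromov_product w y v) - \<delta> \<le> gromov_product w x v"
    and \<delta>: "0 \<le> \<delta>"
    and step: "\<And>i. dist (z i) (z (Suc i)) \<le> 2"
    and far: "\<And>l. i \<le> l \<Longrightarrow> l \<le> j \<Longrightarrow> D \<le> dist p (z l)"
    and ij: "i \<le> j" "j \<le> i + 2 ^ m"
  shows "D - 1 - real m * \<delta> \<le> gromov_product p (z i) (z j)"
  using far ij
proof (induction m arbitrary: i j)
  case 0
  have "dist (z i) (z j) \<le> 2"
  proof (cases "j = i")
    case False
    then have "j = Suc i" using 0 by simp
    then show ?thesis using step by simp
  qed simp
  moreover have "D \<le> dist (z i) p" "D \<le> dist (z j) p"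
    using 0(1)[of i] 0(1)[of j] 0(2) by (auto simp: dist_commute)
  ultimately show ?case by (simp add: gromov_product_def field_simps)
next
  case (Suc m)
  define l where "l = min j (i + 2 ^ m)"
  have l: "i \<le> l" "l \<le> j" "l \<le> i + 2 ^ m" "j \<le> l + 2 ^ m"
    using Suc.prems by (auto simp: l_def)
  have "D - 1 - real m * \<delta> \<le> gromov_product p (z i) (z l)"
    by (rule Suc.IH) (use Suc.prems l in auto)
  moreover have "D - 1 - real m * \<delta> \<le> gromov_product p (z l) (z j)"
    by (rule Suc.IH) (use Suc.prems l in auto)
  ultimately show ?case using four[of p "z i" "z l" "z j"] by (simp add: algebra_simps)
qed

text \<open>One half of the Morse lemma, with \<open>R\<close> independent of \<open>n\<close>: a
  detour around a ball of radius \<open>D\<close> needs a number of steps exponential in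
  \<open>D\<close>, while \<open>quasi\<close> allows only linearly many.\<close>

lemma geodesic_near_quasigeodesic:
  fixes z :: "nat \<Rightarrow> 'a::metric_space"
  assumes four: "\<And>(w::'a) x y v. min (gromov_product w x y) (gromov_product w y v) - \<delta> \<le> gromov_product w x v"
    and \<delta>: "0 \<le> \<delta>"
    and step: "\<And>i. dist (z i) (z (Suc i)) \<le> 2"
    and quasi: "\<And>i j. i \<le> j \<Longrightarrow> real (j - i) \<le> dist (z i) (z j)"
  obtains R where "\<And>n c u. geodesic_seg c (dist (z 0) (z n)) (z 0) (z n) \<Longrightarrow>
     0 \<le> u \<Longrightarrow> u \<le> dist (z 0) (z n) \<Longrightarrow> \<exists>i. dist (c u) (z i) \<le> R"
proof -
  \<comment> \<open>From the exponent \<open>m0\<close> on, \<open>2 ^ m\<close> exceeds the linear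
    expression. Below, \<open>2 ^ m < 12 * D\<close> and
    \<open>D \<le> 1 + (real m + 2) * \<delta>\<close> hold together, which forces
    \<open>m < m0\<close>.\<close>
  have "\<forall>\<^sub>F m::nat in sequentially. 12 * (1 + (real m + 2) * \<delta>) < 2 ^ m"
    by real_asymp
  then obtain m0 :: nat where m0: "\<And>m. m0 \<le> m \<Longrightarrow> 12 * (1 + (real m + 2) * \<delta>) < 2 ^ m"
    unfolding eventually_sequentially by blast
  define R where "R = 1 + (real m0 + 2) * \<delta>"
  have R1: "1 \<le> R" using \<delta> by (simp add: R_def)
  show thesis
  proof (rule that)
    fix n c u
    define L where "L = dist (z 0) (z n)"
    assume c': "geodesic_seg c (dist (z 0) (z n)) (z 0) (z n)"
      and u': "0 \<le> u" "u \<le> dist (z 0) (z n)"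
    note c = c'[folded L_def] and u = u'[folded L_def]
    define \<rho> where "\<rho> t = Min ((\<lambda>i. dist (c t) (z i)) ` {..n})" for t
    have \<rho>_le: "\<rho> t \<le> dist (c t) (z i)" if "i \<le> n" for t i
      using that unfolding \<rho>_def by (intro Min_le) auto
    have \<rho>_ex: "\<exists>i\<le>n. \<rho> t = dist (c t) (z i)" for t
    proof -
      have "\<rho> t \<in> (\<lambda>i. dist (c t) (z i)) ` {..n}"
        unfolding \<rho>_def by (intro Min_in) auto
      then show ?thesis by auto
    qed
    have cdist: "dist (c s) (c t) = \<bar>s - t\<bar>" if "s \<in> {0..L}" "t \<in> {0..L}" for s t
      using c that unfolding geodesic_seg_def by auto
    have "\<rho> t \<le> \<rho> s + \<bar>s - t\<bar>" if "s \<in> {0..L}" "t \<in> {0..L}" for s t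
    proof -
      obtain i where "i \<le> n" "\<rho> s = dist (c s) (z i)" using \<rho>_ex by blast
      then show ?thesis using \<rho>_le[of i t] dist_triangle[of "c t" "z i" "c s"] cdist[OF that]
        by (simp add: dist_commute)
    qed
    then have "1-lipschitz_on {0..L} \<rho>"
      by (intro lipschitz_onI) (force simp: dist_real_def abs_le_iff)+
    then have "continuous_on {0..L} \<rho>" by (rule lipschitz_on_continuous_on)
    then obtain u0 where u0: "u0 \<in> {0..L}" "\<And>t. t \<in> {0..L} \<Longrightarrow> \<rho> t \<le> \<rho> u0"
      using continuous_attains_sup[of "{0..L}" \<rho>] u by auto
    \<comment> \<open>\<open>p\<close> is the point of the geodesic farthest from the sequence; walking \<open>2 * D\<close> along the
      geodesic to either side and then jumping to the sequence gives points \<open>z i\<close>, \<open>z j\<close> joined by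
      at most \<open>6 * D\<close> steps outside the ball of radius \<open>D\<close> about \<open>p\<close>, whereas their Gromov product
      at \<open>p\<close> is bounded.\<close>
    define D where "D = \<rho> u0"
    define p where "p = c u0"
    have far: "D \<le> dist p (z l)" if "l \<le> n" for l
      using \<rho>_le[OF that] by (simp add: D_def p_def)
    have "D \<le> R"
    proof (rule ccontr)
      assume "\<not> D \<le> R"
      then have D: "R < D" by simp
      have D0: "D > 0" using D R1 by linarith
      define s where "s = max 0 (u0 - 2 * D)"
      define t where "t = min L (u0 + 2 * D)"
      have st: "s \<in> {0..L}" "t \<in> {0..L}" "s \<le> u0" "u0 \<le> t" "t - s \<le> 4 * D"
        using u0(1) D0 by (auto simp: s_def t_def)
      obtain i where i: "i \<le> n" "\<rho> s = dist (c s) (z i)" using \<rho>_ex by blast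
      obtain j where j: "j \<le> n" "\<rho> t = dist (c t) (z j)" using \<rho>_ex by blast
      have near: "dist (c s) (z i) \<le> D" "dist (c t) (z j) \<le> D"
        using i j u0(2)[OF st(1)] u0(2)[OF st(2)] by (auto simp: D_def)
      \<comment> \<open>If \<open>s\<close> is cut off at 0, then \<open>c s = z 0\<close> makes
        \<open>\<rho> s\<close> vanish, so \<open>z i = c s\<close> and the product is
        \<open>dist p (z i)\<close>. Otherwise \<open>c s\<close> has distance \<open>2 * D\<close>
        from \<open>p\<close>, and the product is at least
        \<open>(2 * D + D - D) / 2\<close>.\<close>
      have gi: "D \<le> gromov_product p (c s) (z i)"
      proof (cases "u0 - 2 * D \<le> 0")
        case True
        then have s0: "c s = z 0" using c unfolding geodesic_seg_def s_def by simp
        then have "c s = z i" using i \<rho>_le[of 0 s] by simp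
        then show ?thesis using far[OF i(1)] by (simp add: gromov_product_def dist_commute)
      next
        case False
        then have "dist (c s) p = 2 * D"
          using cdist[OF st(1) u0(1)] D0 by (simp add: p_def s_def)
        then show ?thesis using near far[OF i(1)] by (simp add: gromov_product_def dist_commute)
      qed
      have gj: "D \<le> gromov_product p (c t) (z j)"
      proof (cases "L \<le> u0 + 2 * D")
        case True
        then have s0: "c t = z n" using c unfolding geodesic_seg_def t_def by simp
        then have "c t = z j" using j \<rho>_le[of n t] by simp
        then show ?thesis using far[OF j(1)] by (simp add: gromov_product_def dist_commute)
      next
        case False
        then have "dist (c t) p = 2 * D"
          using cdist[OF st(2) u0(1)] D0 by (simp add: p_def t_def)
        then show ?thesis using near far[OF j(1)] by (simp add: gromov_product_def dist_commute)
      qed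
      \<comment> \<open>The point \<open>p\<close> lies between \<open>c s\<close> and
        \<open>c t\<close> on a geodesic. Since \<open>gi\<close> and \<open>gj\<close> exceed
        \<open>2 * \<delta>\<close>, two uses of the four-point inequality pass this smallness on to
        \<open>z i\<close> and \<open>z j\<close>.\<close>
      have "gromov_product p (c s) (c t) = 0"
        using cdist[OF st(1) u0(1)] cdist[OF st(2) u0(1)] cdist[OF st(1,2)] st
        by (simp add: gromov_product_def p_def)
      moreover have "2 * \<delta> < D"
      proof -
        have "2 * \<delta> \<le> (real m0 + 2) * \<delta>" using \<delta> by (intro mult_right_mono) auto
        then show ?thesis using D by (simp add: R_def)
      qed
      ultimately have small: "gromov_product p (z i) (z j) \<le> 2 * \<delta>"
        using four[of p "c s" "z i" "c t"] four[of p "z i" "z j" "c t"] gi gj \<delta>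
        by (auto simp: gromov_product_commute min_def split: if_splits)
      have dij: "dist (z i) (z j) \<le> 6 * D"
        using near cdist[OF st(1,2)] st dist_triangle[of "z i" "z j" "c s"]
          dist_triangle[of "c s" "z j" "c t"] by (simp add: dist_commute)
      have D1: "1 < D" using D R1 by linarith
      obtain m' :: nat where "6 * D < 2 ^ m'"
        using real_arch_pow[of 2 "6 * D"] by auto
      \<comment> \<open>The least such exponent also satisfies
        \<open>2 ^ m < 12 * D\<close>.\<close>
      define m where "m = (LEAST m. 6 * D \<le> 2 ^ m)"
      have m: "6 * D \<le> 2 ^ m"
        unfolding m_def using \<open>6 * D < 2 ^ m'\<close> by (intro LeastI[of "\<lambda>m. 6 * D \<le> 2 ^ m" m']) simp
      have "m \<noteq> 0" using m D1 by (cases m) auto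
      then obtain m1 where m1: "m = Suc m1" using not0_implies_Suc by blast
      have "\<not> 6 * D \<le> 2 ^ m1"
        using not_less_Least[of m1 "\<lambda>m. 6 * D \<le> 2 ^ m"] m1 unfolding m_def by simp
      then have m2: "2 ^ m < 12 * D" using m1 by simp
      \<comment> \<open>Nothing forces \<open>i \<le> j\<close>, so the indices are sorted before
        the chain estimate is applied.\<close>
      define a b where "a = min i j" and "b = max i j"
      have ab: "a \<le> b" "b \<le> n" using i j by (auto simp: a_def b_def)
      have dab: "dist (z a) (z b) \<le> 6 * D" "gromov_product p (z a) (z b) \<le> 2 * \<delta>"
        using dij small by (auto simp: a_def b_def min_def max_def dist_commute gromov_product_commute)
      have "real (b - a) \<le> 2 ^ m" using quasi[OF ab(1)] dab m by linarith
      then have "b - a \<le> 2 ^ m" by (metis of_nat_le_iff of_nat_numeral of_nat_power)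
      then have "b \<le> a + 2 ^ m" using ab by simp
      then have "D - 1 - real m * \<delta> \<le> gromov_product p (z a) (z b)"
        using ab by (intro gromov_product_chain four \<delta> step far) auto
      then have Dm: "D \<le> 1 + (real m + 2) * \<delta>" using dab by (simp add: algebra_simps)
      have "m < m0"
      proof (rule ccontr)
        assume "\<not> m < m0"
        then have "12 * (1 + (real m + 2) * \<delta>) < 2 ^ m" using m0 by simp
        moreover have "12 * D \<le> 12 * (1 + (real m + 2) * \<delta>)"
          using Dm by (rule mult_left_mono) simp
        ultimately show False using m2 by (meson less_asym order.strict_trans1)
      qed
      then have "(real m + 2) * \<delta> \<le> (real m0 + 2) * \<delta>"
        using \<delta> by (intro mult_right_mono) auto
      then show False using Dm D by (simp add: R_def)
    qed
    then have "\<rho> u \<le> R" using u0(2)[of u] u by (simp add: D_def)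
    then show "\<exists>i. dist (c u) (z i) \<le> R" using \<rho>_ex[of u] by auto
  qed
qed

section \<open>Busemann functions near the endpoint of a ray\<close>

text \<open>Fellow travelling is used twice: at \<open>g T\<close>, between the sides to
  \<open>x\<close> and to \<open>g 0\<close>, it brings the side from \<open>x\<close> to
  \<open>g T\<close> within \<open>e\<close> of \<open>g S\<close>; at \<open>x\<close>, it carries
  this over to \<open>c\<close>.\<close>

lemma geodesic_shadows_ray:
  fixes g :: "real \<Rightarrow> 'a::metric_space"
  assumes geo: "geodesic_space TYPE('a)" and ft: "fellow_travel M e TYPE('a)" and M: "0 \<le> M"
    and ray: "geodesic_ray g"
    and S: "M + dist x (g 0) \<le> S" "S \<le> T"
    and gp: "dist x (g 0) + S + M \<le> gromov_product x z (g T)"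
    and c: "geodesic_seg c (dist x z) x z"
  obtains v where "0 \<le> v" "v \<le> dist x z" "dist (c v) (g S) \<le> 2 * e"
proof -
  define b where "b = dist x (g T)"
  define u where "u = T - S"
  have S0: "0 \<le> S" using S M zero_le_dist[of x "g 0"] by linarith
  have T0: "0 \<le> T" using S0 S by linarith
  have dT: "dist (g T) (g 0) = T" using geodesic_ray_dist[OF ray, of T 0] T0 by simp
  have b: "T - dist x (g 0) \<le> b" "b \<le> dist x (g 0) + T"
    using dist_triangle[of "g T" "g 0" x] dist_triangle[of x "g T" "g 0"] dT
    by (auto simp: b_def dist_commute)
  obtain c1 where c1: "geodesic_seg c1 b x (g T)"
    using geo unfolding geodesic_space_def b_def by blast
  have r1: "geodesic_seg (\<lambda>t. c1 (b - t)) (dist (g T) x) (g T) x"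
    using geodesic_seg_reverse[OF c1] by (simp add: b_def dist_commute)
  have r2: "geodesic_seg (\<lambda>t. g (T - t)) (dist (g T) (g 0)) (g T) (g 0)"
    using geodesic_seg_reverse[OF geodesic_ray_seg[OF ray T0]] dT by simp
  have "u + M \<le> gromov_product (g T) x (g 0)"
    using S b dT by (simp add: u_def gromov_product_def b_def dist_commute field_simps)
  then have d1: "dist (c1 (b - u)) (g S) \<le> e"
    using ft[unfolded fellow_travel_def, rule_format, OF r1 r2, of u] S by (simp add: u_def)
  have v: "0 \<le> b - u" "b - u \<le> dist x (g 0) + S"
    using S b M by (auto simp: u_def)
  have "dist (c1 (b - u)) (c (b - u)) \<le> e"
    using ft[unfolded fellow_travel_def, rule_format, OF c1[unfolded b_def] c, of "b - u"] v gp
    by (simp add: b_def gromov_product_commute)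
  then have "dist (c (b - u)) (g S) \<le> 2 * e"
    using d1 dist_triangle[of "c (b - u)" "g S" "c1 (b - u)"] by (simp add: dist_commute)
  moreover have "b - u \<le> dist x z"
    using v gp M gromov_product_le[of x z "g T"] by linarith
  ultimately show thesis using that v by blast
qed

text \<open>Choose \<open>S\<close> where the Busemann difference is within \<open>e/2\<close> of
  its limit. A geodesic from \<open>x\<close> to \<open>z\<close> passes within \<open>e/4\<close>
  of \<open>g S\<close>, so the path from \<open>x\<close> to \<open>z\<close> through
  \<open>g S\<close> is at most \<open>e/2\<close> too long, and \<open>dist q z\<close> is
  estimated through \<open>g S\<close>.\<close>

lemma busemann_upper_bound:
  fixes g :: "real \<Rightarrow> 'a::metric_space"
  assumes k: "k > 0" and cat: "CAT_neg k TYPE('a)" and ray: "geodesic_ray g"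
    and lim: "((\<lambda>t. dist (g t) q - dist (g t) x) \<longlongrightarrow> l) at_top" and e: "e > 0"
  obtains K S where "\<And>z T. S \<le> T \<Longrightarrow> K \<le> gromov_product x z (g T) \<Longrightarrow> dist q z - dist x z \<le> l + e"
proof -
  have geo: "geodesic_space TYPE('a)" using cat by (simp add: CAT_neg_def)
  obtain M where M: "M > 0" "fellow_travel M (e/8) TYPE('a)"
    using CAT_neg_fellow_travel[OF k cat, of "e/8"] e by auto
  have "\<forall>\<^sub>F t in at_top. dist (g t) q - dist (g t) x < l + e/2"
    using order_tendstoD(2)[OF lim, of "l + e/2"] e by simp
  then have "\<forall>\<^sub>F t in at_top. dist (g t) q - dist (g t) x < l + e/2 \<and> M + dist x (g 0) \<le> t"
    by (rule eventually_conj) (rule eventually_ge_at_top)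
  then obtain S where S: "dist (g S) q - dist (g S) x < l + e/2" "M + dist x (g 0) \<le> S"
    using eventually_happens'[OF trivial_limit_at_top_linorder] by blast
  show thesis
  proof (rule that)
    fix z T assume T: "S \<le> T" and gp: "dist x (g 0) + S + M \<le> gromov_product x z (g T)"
    obtain c where c: "geodesic_seg c (dist x z) x z"
      using geo unfolding geodesic_space_def by blast
    obtain v where v: "0 \<le> v" "v \<le> dist x z" "dist (c v) (g S) \<le> 2 * (e/8)"
      using geodesic_shadows_ray[OF geo M(2) _ ray S(2) T gp c] M(1) by auto
    have "dist x (g S) + dist (g S) z \<le> dist x z + e/2"
      using geodesic_seg_dist[OF c v(1,2)] v(3) dist_triangle[of x "g S" "c v"]
        dist_triangle[of "g S" z "c v"] by (simp add: dist_commute)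
    then show "dist q z - dist x z \<le> l + e"
      using S(1) dist_triangle[of q z "g S"] by (simp add: dist_commute)
  qed
qed

section \<open>Comparison of \<open>dprime\<close> with the original distance\<close>

lemma admissible_norm_le:
  assumes N: "admissible_monotone_norm N" and ab: "0 \<le> b" "b \<le> a"
  shows "N (a, b) \<le> a"
proof -
  have "N (a, b) \<le> N (a * 1, a * 1)"
    using N ab unfolding admissible_monotone_norm_def by simp
  also have "\<dots> = \<bar>a\<bar> * N (1, 1)"
    using N unfolding admissible_monotone_norm_def is_norm2_def by blast
  finally show ?thesis using N ab unfolding admissible_monotone_norm_def by simp
qed

text \<open>The one-step subdivision with points 0 and 1 already gives this lower bound, which sees
  only the endpoints of the path.\<close>

lemma Nlength_ge:
  assumes N: "admissible_monotone_norm N"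
  shows "ereal ((dist (p 0) (p 1) + \<bar>h (p 0) - h (p 1)\<bar>) / 2) \<le> Nlength N h p"
proof -
  have sup: "ereal (\<Sum>i<1. N (dist (p (real i)) (p (real (Suc i))), \<bar>h (p (real i)) - h (p (real (Suc i)))\<bar>))
      \<le> Nlength N h p"
    unfolding Nlength_def by (intro Sup_upper CollectI exI[of _ "1::nat"] exI[of _ real]) auto
  have "(dist (p 0) (p 1) + \<bar>h (p 0) - h (p 1)\<bar>) / 2 \<le> N (dist (p 0) (p 1), \<bar>h (p 0) - h (p 1)\<bar>)"
    using N unfolding admissible_monotone_norm_def
    by (metis abs_idempotent abs_of_nonneg zero_le_dist)
  then have "ereal ((dist (p 0) (p 1) + \<bar>h (p 0) - h (p 1)\<bar>) / 2) \<le> ereal (N (dist (p 0) (p 1), \<bar>h (p 0) - h (p 1)\<bar>))"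
    by simp
  also have "\<dots> \<le> Nlength N h p" using sup by simp
  finally show ?thesis .
qed

text \<open>As height differences are at most distances, each summand is at most the length of its
  subinterval, and these lengths telescope.\<close>

lemma Nlength_geodesic_le:
  assumes N: "admissible_monotone_norm N" and h: "\<And>x y. \<bar>h x - h y\<bar> \<le> dist x y"
    and c: "geodesic_seg c L x y"
  shows "Nlength N h (\<lambda>s. c (s * L)) \<le> ereal L"
  unfolding Nlength_def
proof (rule Sup_least, clarify)
  fix n :: nat and t :: "nat \<Rightarrow> real"
  assume t: "t 0 = 0" "t n = 1" "\<forall>i<n. t i < t (Suc i)"
  have L: "0 \<le> L" using c by (simp add: geodesic_seg_def)
  have mono: "t i \<le> t j" if "i \<le> j" "j \<le> n" for i j
    using that
  proof (induction j rule: dec_induct)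
    case (step l)
    then have "t i \<le> t l" "t l < t (Suc l)" using t(3) by auto
    then show ?case by linarith
  qed simp
  have rng: "t i * L \<in> {0..L}" if "i \<le> n" for i
    using mono[of 0 i] mono[of i n] that t L by (auto intro: mult_left_le_one_le)
  have "(\<Sum>i<n. N (dist (c (t i * L)) (c (t (Suc i) * L)), \<bar>h (c (t i * L)) - h (c (t (Suc i) * L))\<bar>))
      \<le> (\<Sum>i<n. t (Suc i) * L - t i * L)"
  proof (rule sum_mono)
    fix i assume "i \<in> {..<n}"
    then have i: "i \<le> n" "Suc i \<le> n" "t i \<le> t (Suc i)" using mono[of i "Suc i"] by auto
    have "dist (c (t i * L)) (c (t (Suc i) * L)) = \<bar>t i * L - t (Suc i) * L\<bar>"
      using c rng[OF i(1)] rng[OF i(2)] unfolding geodesic_seg_def by blast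
    also have "\<dots> = t (Suc i) * L - t i * L"
      using i(3) L by (simp add: mult_right_mono)
    finally show "N (dist (c (t i * L)) (c (t (Suc i) * L)), \<bar>h (c (t i * L)) - h (c (t (Suc i) * L))\<bar>)
        \<le> t (Suc i) * L - t i * L"
      using admissible_norm_le[OF N _ h[of "c (t i * L)" "c (t (Suc i) * L)"]] by simp
  qed
  also have "\<dots> = L" using t sum_lessThan_telescope[of "\<lambda>i. t i * L" n] by simp
  finally show "ereal (\<Sum>i<n. N (dist (c (t i * L)) (c (t (Suc i) * L)),
        \<bar>h (c (t i * L)) - h (c (t (Suc i) * L))\<bar>)) \<le> ereal L"
    by simp
qed

lemma dprime_bounds:
  fixes h :: "'a::metric_space \<Rightarrow> real"
  assumes geo: "geodesic_space TYPE('a)" and N: "admissible_monotone_norm N"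
    and h: "\<And>x y. \<bar>h x - h y\<bar> \<le> dist x y"
  shows "(dist x y + \<bar>h x - h y\<bar>) / 2 \<le> dprime N h x y" "dprime N h x y \<le> dist x y"
proof -
  define I where "I = Inf {Nlength N h p | p. continuous_on {0..1} p \<and> p 0 = x \<and> p 1 = y}"
  define L where "L = dist x y"
  have lower: "ereal ((dist x y + \<bar>h x - h y\<bar>) / 2) \<le> I"
    unfolding I_def by (rule Inf_greatest) (use Nlength_ge[OF N] in fastforce)
  obtain c where c: "geodesic_seg c L x y"
    using geo unfolding geodesic_space_def L_def by blast
  have L: "0 \<le> L" by (simp add: L_def)
  have "L-lipschitz_on {0..1} (\<lambda>s. c (s * L))"
  proof (rule lipschitz_onI)
    fix s t :: real assume "s \<in> {0..1}" "t \<in> {0..1}"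
    then have "s * L \<in> {0..L}" "t * L \<in> {0..L}"
      using L by (auto intro: mult_left_le_one_le)
    then have "dist (c (s * L)) (c (t * L)) = \<bar>s * L - t * L\<bar>"
      using c unfolding geodesic_seg_def by blast
    then show "dist (c (s * L)) (c (t * L)) \<le> L * dist s t"
      using L by (simp add: dist_real_def abs_mult flip: left_diff_distrib)
  qed (rule L)
  then have "continuous_on {0..1} (\<lambda>s. c (s * L))" by (rule lipschitz_on_continuous_on)
  then have "I \<le> Nlength N h (\<lambda>s. c (s * L))"
    unfolding I_def using c by (intro Inf_lower) (auto simp: geodesic_seg_def)
  then have upper: "I \<le> ereal L"
    using Nlength_geodesic_le[OF N h c] by (rule order_trans)
  have dp: "dprime N h x y = real_of_ereal I" by (simp add: dprime_def I_def)
  \<comment> \<open>Finite bounds on both sides exclude the infinite values, which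
    \<open>real_of_ereal\<close> would send to 0.\<close>
  obtain r where "I = ereal r" using lower upper by (cases I) auto
  then show "(dist x y + \<bar>h x - h y\<bar>) / 2 \<le> dprime N h x y" "dprime N h x y \<le> dist x y"
    using lower upper by (auto simp: dp L_def)
qed

section \<open>Existence and basic properties of the height function\<close>

text \<open>\<open>Lim\<close> is meaningful only when the limit exists. It does, because
  \<open>dist (g t) y - t\<close> is non-increasing in \<open>t\<close> and bounded below by
  \<open>- dist (g 0) y\<close>.\<close>

lemma height_tendsto:
  assumes ray: "geodesic_ray g"
  shows "((\<lambda>t. dist (g t) x - dist (g t) x0) \<longlongrightarrow> - height g x0 x) at_top"
proof -
  have "\<exists>l. ((\<lambda>t. dist (g t) y - t) \<longlongrightarrow> l) at_top" for y
  proof -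
    have "dist (g t) y - t \<le> dist (g s) y - s" if "0 \<le> s" "s \<le> t" for s t
      using dist_triangle[of "g t" y "g s"] geodesic_ray_dist[OF ray, of t s] that by simp
    moreover have "- dist (g 0) y \<le> dist (g t) y - t" if "0 \<le> t" for t
      using dist_triangle[of "g t" "g 0" y] geodesic_ray_dist[OF ray, of t 0] that
      by (simp add: dist_commute)
    ultimately obtain l where "((\<lambda>t. dist (g t) y - t) \<longlongrightarrow> l) at_top"
      using nonincreasing_tendsto_at_top[of "\<lambda>t. dist (g t) y - t"] by blast
    then show ?thesis by blast
  qed
  then obtain l l0 where "((\<lambda>t. dist (g t) x - t) \<longlongrightarrow> l) at_top"
      "((\<lambda>t. dist (g t) x0 - t) \<longlongrightarrow> l0) at_top"
    by blast
  from tendsto_diff[OF this]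
  have lim: "((\<lambda>t. dist (g t) x - dist (g t) x0) \<longlongrightarrow> l - l0) at_top" by simp
  then have "Lim at_top (\<lambda>t. dist (g t) x - dist (g t) x0) = l - l0"
    by (intro tendsto_Lim) auto
  then show ?thesis using lim by (simp add: height_def)
qed

lemma busemann_tendsto:
  assumes ray: "geodesic_ray g"
  shows "((\<lambda>t. dist (g t) y - dist (g t) x) \<longlongrightarrow> height g x0 x - height g x0 y) at_top"
  using tendsto_diff[OF height_tendsto[OF ray, of y x0] height_tendsto[OF ray, of x x0]] by simp

lemma height_lipschitz:
  assumes ray: "geodesic_ray g"
  shows "\<bar>height g x0 x - height g x0 y\<bar> \<le> dist x y"
proof -
  have "\<bar>dist (g t) y - dist (g t) x\<bar> \<le> dist x y" for t
    using dist_triangle[of "g t" y x] dist_triangle[of "g t" x y]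
    by (simp add: dist_commute abs_le_iff)
  then show ?thesis
    by (intro tendsto_upperbound[OF tendsto_rabs[OF busemann_tendsto[OF ray]]]) auto
qed

text \<open>The Busemann difference is eventually constant here. The sign in \<open>height\<close>
  makes the height grow towards the boundary point.\<close>

lemma height_along_ray:
  assumes ray: "geodesic_ray g" and s: "0 \<le> s"
  shows "height g x0 (g s) = height g x0 (g 0) + s"
proof -
  have "\<forall>\<^sub>F t in at_top. dist (g t) (g s) - dist (g t) (g 0) = - s"
    using eventually_ge_at_top[of s]
    by eventually_elim (use s in \<open>simp add: geodesic_ray_dist[OF ray]\<close>)
  then have "((\<lambda>t. dist (g t) (g s) - dist (g t) (g 0)) \<longlongrightarrow> - s) at_top"
    by (rule tendsto_eventually)
  with busemann_tendsto[OF ray] have "height g x0 (g 0) - height g x0 (g s) = - s"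
    by (rule tendsto_unique[rotated 1]) simp
  then show ?thesis by simp
qed

section \<open>Asymptotics of the image of the ray\<close>

text \<open>Records in terms of \<open>dist\<close> alone what unit speed for \<open>dprime\<close>
  says about \<open>\<sigma>\<close>: \<open>lower\<close> and \<open>upper\<close> come from the
  two bounds on \<open>dprime\<close>, and \<open>boundary\<close> says that \<open>\<sigma>\<close>
  and \<open>g\<close> converge to the same boundary point.\<close>

locale height_ray_image =
  fixes k :: real and g :: "real \<Rightarrow> 'a::metric_space" and x0 :: 'a and \<sigma> :: "real \<Rightarrow> 'a"
  assumes k: "k > 0" and cat: "CAT_neg k TYPE('a)" and ray: "geodesic_ray g"
    and lower: "\<And>s t. 0 \<le> s \<Longrightarrow> 0 \<le> t \<Longrightarrow> \<bar>s - t\<bar> \<le> dist (\<sigma> s) (\<sigma> t)"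
    and upper: "\<And>s t. 0 \<le> s \<Longrightarrow> 0 \<le> t \<Longrightarrow>
      (dist (\<sigma> s) (\<sigma> t) + \<bar>height g x0 (\<sigma> s) - height g x0 (\<sigma> t)\<bar>) / 2 \<le> \<bar>s - t\<bar>"
    and boundary: "\<And>K. \<exists>t0. \<forall>s\<ge>t0. \<forall>t\<ge>t0. K \<le> gromov_product x0 (\<sigma> s) (g t)"
begin

abbreviation "h \<equiv> height g x0"

lemma geodesic: "geodesic_space TYPE('a)"
  using cat by (simp add: CAT_neg_def)

lemma height_increment_le:
  assumes "0 \<le> s" "s \<le> t"
  shows "h (\<sigma> t) - h (\<sigma> s) \<le> t - s"
  using lower[of s t] upper[of s t] assms by (simp add: abs_le_iff field_simps)

lemma boundary_at:
  obtains t0 where "\<And>s t. t0 \<le> s \<Longrightarrow> t0 \<le> t \<Longrightarrow> K \<le> gromov_product x (\<sigma> s) (g t)"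
proof -
  obtain t0 where t0: "\<And>s t. t0 \<le> s \<Longrightarrow> t0 \<le> t \<Longrightarrow> K + dist x x0 \<le> gromov_product x0 (\<sigma> s) (g t)"
    using boundary[of "K + dist x x0"] by blast
  have "K \<le> gromov_product x (\<sigma> s) (g t)" if "t0 \<le> s" "t0 \<le> t" for s t
    using t0[OF that] gromov_product_base[of x0 "\<sigma> s" "g t" x] by linarith
  then show thesis by (rule that)
qed

text \<open>The defect \<open>t - h (\<sigma> t)\<close> is non-decreasing, so it suffices to bound
  it at some later index \<open>i\<close>. Such an \<open>i\<close> is found with
  \<open>\<sigma> i\<close> near a point \<open>g S\<close> far out on the ray, where the height is
  \<open>S\<close> up to a constant and \<open>i\<close> exceeds \<open>S\<close> by at most a
  constant.\<close>

lemma height_defect_bounded: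
  obtains C where "\<And>t. 0 \<le> t \<Longrightarrow> t - h (\<sigma> t) \<le> C"
proof -
  obtain M where M: "M > 0" "fellow_travel M 1 TYPE('a)"
    using CAT_neg_fellow_travel[OF k cat, of 1] by auto
  define z where "z i = \<sigma> (real i)" for i
  have step: "dist (z i) (z (Suc i)) \<le> 2" for i
    using upper[of "real i" "real (Suc i)"] unfolding z_def by (simp add: field_simps)
  have quasi: "real (j - i) \<le> dist (z i) (z j)" if "i \<le> j" for i j
    using lower[of "real i" "real j"] that unfolding z_def by (simp add: of_nat_diff)
  obtain R where R: "\<And>n c u. geodesic_seg c (dist (z 0) (z n)) (z 0) (z n) \<Longrightarrow>
     0 \<le> u \<Longrightarrow> u \<le> dist (z 0) (z n) \<Longrightarrow> \<exists>i. dist (c u) (z i) \<le> R"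
    using geodesic_near_quasigeodesic[of "M + 1" z, OF fellow_travel_four_point[OF geodesic M(2)] _ step quasi]
      M(1) by auto
  \<comment> \<open>The 2 is twice the fellow-travelling constant 1; the absolute value makes
    \<open>R'\<close> nonnegative.\<close>
  define R' where "R' = \<bar>R\<bar> + 2"
  define x where "x = \<sigma> 0"
  define A where "A = dist x (g 0)"
  have A: "0 \<le> A" by (simp add: A_def)
  have "t - h (\<sigma> t) \<le> A + 2 * R' - h (g 0)" if t: "0 \<le> t" for t
  proof -
    \<comment> \<open>Large enough for the shadowing lemma, and for
      \<open>S \<le> A + 2 * real i + R'\<close> to force \<open>t \<le> real i\<close>.\<close>
    define S where "S = M + A + 2 * t + R'"
    have S0: "0 \<le> S" using M A t by (simp add: S_def R'_def)
    obtain t0 where t0: "\<And>s t. t0 \<le> s \<Longrightarrow> t0 \<le> t \<Longrightarrow> A + S + M \<le> gromov_product x (\<sigma> s) (g t)"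
      using boundary_at by blast
    obtain n :: nat where n: "t0 \<le> real n" using real_arch_simple by blast
    define T where "T = max S t0"
    have gp: "dist x (g 0) + S + M \<le> gromov_product x (z n) (g T)"
      using t0[of "real n" T] n by (simp add: T_def z_def A_def)
    obtain c where c: "geodesic_seg c (dist x (z n)) x (z n)"
      using geodesic unfolding geodesic_space_def by blast
    have "M + dist x (g 0) \<le> S" "S \<le> T" using t by (auto simp: S_def T_def A_def R'_def)
    then obtain v where v: "0 \<le> v" "v \<le> dist x (z n)" "dist (c v) (g S) \<le> 2 * 1"
      using geodesic_shadows_ray[OF geodesic M(2) _ ray _ _ gp c] M(1) by auto
    have x: "x = z 0" by (simp add: x_def z_def)
    \<comment> \<open>The point \<open>c v\<close> is close to \<open>g S\<close> by shadowing and
      to some \<open>z i\<close> by stability, which links the ray with the sequence.\<close>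
    obtain i where i: "dist (c v) (z i) \<le> R"
      using R[of c n v] c v unfolding x by blast
    have near: "dist (z i) (g S) \<le> R'"
      using i v(3) dist_triangle[of "z i" "g S" "c v"] by (simp add: R'_def dist_commute)
    have gS: "dist (g 0) (g S) = S" using geodesic_ray_dist[OF ray, of 0 S] S0 by simp
    have "dist x (z i) \<le> A + S + R'"
      using dist_triangle[of x "z i" "g 0"] dist_triangle[of "g 0" "z i" "g S"] near gS
      by (simp add: A_def dist_commute)
    moreover have "real i \<le> dist x (z i)" using quasi[of 0 i] by (simp add: x)
    ultimately have i_le: "real i \<le> A + S + R'" by linarith
    have "S \<le> A + dist x (z i) + R'"
      using dist_triangle[of "g 0" "g S" x] dist_triangle[of x "g S" "z i"] near gS
      by (simp add: A_def dist_commute)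
    moreover have "dist x (z i) \<le> 2 * real i"
      using upper[of 0 "real i"] by (simp add: x_def z_def field_simps)
    ultimately have ti: "t \<le> real i" using M by (simp add: S_def)
    have "h (g 0) + S - R' \<le> h (z i)"
      using height_lipschitz[OF ray, of x0 "z i" "g S"] height_along_ray[OF ray S0, of x0] near
      by (simp add: abs_le_iff)
    then show ?thesis
      using i_le height_increment_le[OF t ti] by (simp add: z_def)
  qed
  then show thesis by (rule that)
qed

text \<open>Nonnegativity is the Lipschitz bound on \<open>h\<close>. For the upper bound,
  convergence of the defect makes \<open>t - s\<close> nearly equal to
  \<open>h (\<sigma> t) - h (\<sigma> s)\<close>, so \<open>upper\<close> leaves
  \<open>dist (\<sigma> s) (\<sigma> t)\<close> at most \<open>e/2\<close> above that difference;
  the Busemann estimate replaces \<open>\<sigma> s\<close> by \<open>y\<close> at cost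
  \<open>e/8\<close>.\<close>

lemma asymptotically_vertical:
  "((\<lambda>t. dist (\<sigma> t) y - (h (\<sigma> t) - h y)) \<longlongrightarrow> 0) at_top"
proof (rule tendstoI)
  fix e :: real assume e: "e > 0"
  obtain C where C: "\<And>t. 0 \<le> t \<Longrightarrow> t - h (\<sigma> t) \<le> C" using height_defect_bounded by blast
  obtain l where l: "((\<lambda>t. t - h (\<sigma> t)) \<longlongrightarrow> l) at_top"
  proof -
    have "- (s - h (\<sigma> s)) \<ge> - (t - h (\<sigma> t))" if "0 \<le> s" "s \<le> t" for s t
      using height_increment_le[OF that] by simp
    moreover have "- C \<le> - (t - h (\<sigma> t))" if "0 \<le> t" for t using C[OF that] by simp
    ultimately obtain l' where "((\<lambda>t. - (t - h (\<sigma> t))) \<longlongrightarrow> l') at_top"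
      using nonincreasing_tendsto_at_top[of "\<lambda>t. - (t - h (\<sigma> t))" "- C"] by blast
    from tendsto_minus[OF this] show thesis by (intro that) simp
  qed
  have "\<forall>\<^sub>F t in at_top. \<bar>t - h (\<sigma> t) - l\<bar> < e/8 \<and> 0 \<le> t"
    using tendstoD[OF l, of "e/8"] e
    by (intro eventually_conj eventually_ge_at_top) (simp add: dist_real_def)
  then obtain s where s: "\<And>t. s \<le> t \<Longrightarrow> \<bar>t - h (\<sigma> t) - l\<bar> < e/8 \<and> 0 \<le> t"
    unfolding eventually_at_top_linorder by blast
  \<comment> \<open>\<open>K\<close> and \<open>S\<close> depend on \<open>s\<close>, so
    \<open>s\<close> is fixed before \<open>t\<close> is taken large.\<close>
  obtain K S where KS: "\<And>z T. S \<le> T \<Longrightarrow> K \<le> gromov_product (\<sigma> s) z (g T) \<Longrightarrow>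
      dist y z - dist (\<sigma> s) z \<le> h (\<sigma> s) - h y + e/8"
    by (rule busemann_upper_bound[OF k cat ray busemann_tendsto[OF ray, of y "\<sigma> s" x0], of "e/8"])
      (use e in auto)
  obtain t0 where t0: "\<And>t T. t0 \<le> t \<Longrightarrow> t0 \<le> T \<Longrightarrow> K \<le> gromov_product (\<sigma> s) (\<sigma> t) (g T)"
    using boundary_at by blast
  show "\<forall>\<^sub>F t in at_top. dist (dist (\<sigma> t) y - (h (\<sigma> t) - h y)) 0 < e"
    using eventually_ge_at_top[of "max s t0"]
  proof eventually_elim
    case (elim t)
    then have st: "s \<le> t" "t0 \<le> t" by auto
    have s0: "0 \<le> s" "0 \<le> t" using s st by auto
    have "dist y (\<sigma> t) - dist (\<sigma> s) (\<sigma> t) \<le> h (\<sigma> s) - h y + e/8"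
      using KS[of "max S t0" "\<sigma> t"] t0[of t "max S t0"] st by simp
    moreover have "t - s - e/4 \<le> h (\<sigma> t) - h (\<sigma> s)"
    proof -
      have "\<bar>t - h (\<sigma> t) - l\<bar> < e/8" "\<bar>s - h (\<sigma> s) - l\<bar> < e/8"
        using s st by auto
      then show ?thesis unfolding abs_less_iff by linarith
    qed
    moreover have "dist (\<sigma> s) (\<sigma> t) + (h (\<sigma> t) - h (\<sigma> s)) \<le> 2 * (t - s)"
      using upper[OF s0] st by (simp add: abs_if split: if_splits)
    moreover have "h (\<sigma> t) - h y \<le> dist (\<sigma> t) y"
      using height_lipschitz[OF ray, of x0 "\<sigma> t" y] by (simp add: abs_le_iff)
    ultimately show ?case using e by (simp add: dist_commute dist_real_def)
  qed
qed

end

section \<open>Constancy of the height change\<close>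

theorem mainTheorem12:
  fixes k :: real and \<gamma> :: "real \<Rightarrow> 'a::metric_space" and x0 :: 'a
    and N :: "real \<times> real \<Rightarrow> real" and f :: "'a \<Rightarrow> 'a"
  assumes "k > 0"
    and "proper_space TYPE('a)"
    and "geodesically_complete TYPE('a)"
    and "CAT_neg k TYPE('a)"
    and "geodesic_ray \<gamma>"
    and "admissible_monotone_norm N"
    and "bij f"
    and "\<forall>x y. dprime N (height \<gamma> x0) (f x) (f y) = dprime N (height \<gamma> x0) x y"
    and "filterlim (\<lambda>(s, t). gromov_product x0 (f (\<gamma> s)) (\<gamma> t)) at_top (at_top \<times>\<^sub>F at_top)"
  shows "\<exists>c. \<forall>x. height \<gamma> x0 (f x) - height \<gamma> x0 x = c"
proof -
  note ray = assms(5)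
  define h where "h = height \<gamma> x0"
  define d' where "d' = dprime N h"
  have geo: "geodesic_space TYPE('a)" using assms(4) by (simp add: CAT_neg_def)
  have lip: "\<bar>h x - h y\<bar> \<le> dist x y" for x y
    unfolding h_def by (rule height_lipschitz[OF ray])
  have bounds: "(dist x y + \<bar>h x - h y\<bar>) / 2 \<le> d' x y" "d' x y \<le> dist x y" for x y
    unfolding d'_def by (rule dprime_bounds[OF geo assms(6) lip])+
  have height_le: "h x - h y \<le> d' x y" for x y
  proof -
    have "\<bar>h x - h y\<bar> \<le> (dist x y + \<bar>h x - h y\<bar>) / 2"
      using lip[of x y] by simp
    also have "\<dots> \<le> d' x y" by (rule bounds)
    finally show ?thesis by simp
  qed
  have iso: "d' (f x) (f y) = d' x y" for x y
    using assms(8) by (simp add: d'_def h_def)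
  define \<sigma> where "\<sigma> t = f (\<gamma> t)" for t
  \<comment> \<open>On \<open>\<gamma>\<close> height differences equal distances up to sign, so the
    lower and upper bounds on \<open>d'\<close> coincide.\<close>
  have unit_speed: "d' (\<sigma> s) (\<sigma> t) = \<bar>s - t\<bar>" if st: "0 \<le> s" "0 \<le> t" for s t
  proof -
    have "dist (\<gamma> s) (\<gamma> t) = \<bar>s - t\<bar>" by (rule geodesic_ray_dist[OF ray st])
    moreover have "h (\<gamma> s) - h (\<gamma> t) = s - t"
      unfolding h_def by (simp only: height_along_ray[OF ray st(1)] height_along_ray[OF ray st(2)])
    ultimately show ?thesis
      using bounds[of "\<gamma> s" "\<gamma> t"] unfolding \<sigma>_def iso by simp
  qed
  interpret height_ray_image k \<gamma> x0 \<sigma>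
  proof
    fix s t :: real assume st: "0 \<le> s" "0 \<le> t"
    show "\<bar>s - t\<bar> \<le> dist (\<sigma> s) (\<sigma> t)"
      using bounds(2)[of "\<sigma> s" "\<sigma> t"] unit_speed[OF st] by simp
    show "(dist (\<sigma> s) (\<sigma> t) + \<bar>height \<gamma> x0 (\<sigma> s) - height \<gamma> x0 (\<sigma> t)\<bar>) / 2 \<le> \<bar>s - t\<bar>"
      using bounds(1)[of "\<sigma> s" "\<sigma> t"] unit_speed[OF st] by (simp add: h_def)
  next
    fix K :: real
    have "\<forall>\<^sub>F p in at_top \<times>\<^sub>F at_top. K \<le> (case p of (s, t) \<Rightarrow> gromov_product x0 (f (\<gamma> s)) (\<gamma> t))"
      using assms(9) by (auto simp: filterlim_at_top)
    then obtain P Q where P: "eventually P at_top" and Q: "eventually Q at_top"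
      and PQ: "\<And>s t. P s \<Longrightarrow> Q t \<Longrightarrow> K \<le> gromov_product x0 (f (\<gamma> s)) (\<gamma> t)"
      unfolding eventually_prod_filter by auto
    obtain t0 where "\<forall>t\<ge>t0. P t \<and> Q t"
      using eventually_conj[OF P Q] unfolding eventually_at_top_linorder by blast
    then show "\<exists>t0. \<forall>s\<ge>t0. \<forall>t\<ge>t0. K \<le> gromov_product x0 (\<sigma> s) (\<gamma> t)"
      using PQ unfolding \<sigma>_def by blast
  qed (use assms in auto)
  have lim: "((\<lambda>t. h (\<sigma> t) - h (\<gamma> t)) \<longlongrightarrow> h (f x) - h x) at_top" for x
  proof -
    have "((\<lambda>t. dist (\<gamma> t) x - (h (\<gamma> t) - h x)) \<longlongrightarrow> 0) at_top"
    proof -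
      \<comment> \<open>Along the ray \<open>dist (\<gamma> t) (\<gamma> 0) = t = h (\<gamma> t) - h
        (\<gamma> 0)\<close>, so the Busemann limit is the claim in another form.\<close>
      have "((\<lambda>t. dist (\<gamma> t) x - dist (\<gamma> t) (\<gamma> 0) - (h (\<gamma> 0) - h x)) \<longlongrightarrow> 0) at_top"
        unfolding h_def by (rule tendsto_diff[OF busemann_tendsto[OF ray] tendsto_const, THEN tendsto_eq_rhs]) simp
      moreover have "\<forall>\<^sub>F t in at_top. dist (\<gamma> t) x - dist (\<gamma> t) (\<gamma> 0) - (h (\<gamma> 0) - h x)
          = dist (\<gamma> t) x - (h (\<gamma> t) - h x)"
        using eventually_ge_at_top[of 0]
      proof eventually_elim
        case (elim t)
        then show ?case
          using geodesic_ray_dist[OF ray elim, of 0] height_along_ray[OF ray elim, of x0]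
          by (simp add: h_def)
      qed
      ultimately show ?thesis by (simp add: tendsto_cong)
    qed
    then have 1: "((\<lambda>t. d' (\<gamma> t) x - (h (\<gamma> t) - h x)) \<longlongrightarrow> 0) at_top"
    proof (rule tendsto_sandwich[OF _ _ tendsto_const, rotated 2])
      show "\<forall>\<^sub>F t in at_top. 0 \<le> d' (\<gamma> t) x - (h (\<gamma> t) - h x)"
        using height_le by simp
      show "\<forall>\<^sub>F t in at_top. d' (\<gamma> t) x - (h (\<gamma> t) - h x) \<le> dist (\<gamma> t) x - (h (\<gamma> t) - h x)"
        using bounds(2) by simp
    qed
    have 2: "((\<lambda>t. d' (\<sigma> t) (f x) - (h (\<sigma> t) - h (f x))) \<longlongrightarrow> 0) at_top"
    proof (rule tendsto_sandwich[OF _ _ tendsto_const asymptotically_vertical[of "f x", folded h_def]])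
      show "\<forall>\<^sub>F t in at_top. 0 \<le> d' (\<sigma> t) (f x) - (h (\<sigma> t) - h (f x))"
        using height_le by simp
      show "\<forall>\<^sub>F t in at_top. d' (\<sigma> t) (f x) - (h (\<sigma> t) - h (f x)) \<le> dist (\<sigma> t) (f x) - (h (\<sigma> t) - h (f x))"
        using bounds(2) by simp
    qed
    \<comment> \<open>Since \<open>d' (\<sigma> t) (f x) = d' (\<gamma> t) x\<close>, the distances
      cancel in the difference of the two limits and only heights remain.\<close>
    have "((\<lambda>t. h (\<sigma> t) - h (\<gamma> t) - (h (f x) - h x)) \<longlongrightarrow> 0) at_top"
      using tendsto_diff[OF 1 2] by (simp add: \<sigma>_def iso algebra_simps)
    then show ?thesis by (rule LIM_zero_cancel)
  qed
  have "h (f x) - h x = h (f x0) - h x0" for x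
    by (rule tendsto_unique[OF _ lim lim]) simp
  then show ?thesis unfolding h_def by blast
qed

end
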